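(* Let $a,b,c$ be the side lengths of a spherical triangle with circumradius $R$ and inradius $r$. Then $$\frac{\tan R}{\tan r}\ \ge\ \frac{\sin\frac a2\sin\frac b2\sin\frac c2+\sin^3\frac a2+\sin^3\frac b2+\sin^3\frac c2}{2\sin\frac a2\sin\frac b2\sin\frac c2}$$ $$\ge\ \frac{\sin\frac a2}{\sin\frac b2}+\frac{\sin\frac b2}{\sin\frac c2}+\frac{\sin\frac c2}{\sin\frac a2}-1$$ $$\ge\ \frac23\left(\frac{\sin\frac a2}{\sin\frac b2}+\frac{\sin\frac b2}{\sin\frac c2}+\frac{\sin\frac c2}{\sin\frac a2}\right)\ \ge\ 2.$$
   Context: Spherical triangles are nondegenerate and lie on the unit sphere $S^2$ (curvature $1$): the three vertices do not lie on a common great circle and the sides are the minor great-circle arcs joining them, so each side has length in $(0,\pi)$. $R$ and $r$ are the spherical radii, in $(0,\pi/2)$, of the circumscribed and inscribed circles; they satisfy $$\tan R=\frac{2\sin\frac a2\sin\frac b2\sin\frac c2}{\sqrt{\sin\frac{a+b+c}2\sin\frac{a+b-c}2\sin\frac{a+c-b}2\sin\frac{b+c-a}2}},\qquad \tan r=\sqrt{\frac{\sin\frac{a+b-c}2\sin\frac{a+c-b}2\sin\frac{b+c-a}2}{\sin\frac{a+b+c}2}}.$$ *)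

theory Defs
  imports "HOL-Analysis.Analysis"
begin

abbreviation S2 :: "(real^3) set" where
  "S2 \<equiv> sphere 0 1"

text \<open>Geodesic distance on the unit sphere: the length of the minor great-circle arc.\<close>

definition sdist :: "real^3 \<Rightarrow> real^3 \<Rightarrow> real" where
  "sdist x y = arccos (x \<bullet> y)"

text \<open>The great circle with poles \<open>n\<close> and \<open>- n\<close> (up to scaling); meaningful for \<open>n \<noteq> 0\<close>.\<close>

definition great_circle :: "real^3 \<Rightarrow> (real^3) set" where
  "great_circle n = {x \<in> S2. n \<bullet> x = 0}"

definition scircle :: "real^3 \<Rightarrow> real \<Rightarrow> (real^3) set" where
  "scircle P \<rho> = {x \<in> S2. sdist P x = \<rho>}"

definition spherical_triangle :: "real^3 \<Rightarrow> real^3 \<Rightarrow> real^3 \<Rightarrow> bool" where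
  "spherical_triangle A B C \<longleftrightarrow>
     A \<in> S2 \<and> B \<in> S2 \<and> C \<in> S2 \<and> \<not> (\<exists>n. n \<noteq> 0 \<and> {A, B, C} \<subseteq> great_circle n)"

text \<open>
  Since \<open>sgn x = x /\<^sub>R norm x\<close>, the image under \<open>sgn\<close> is the central projection to the
  sphere: chords go to minor arcs, and the plane triangle goes to the closed spherical triangle.
  For a nondegenerate triangle the origin does not lie in the projected set.
\<close>

definition minor_arc :: "real^3 \<Rightarrow> real^3 \<Rightarrow> (real^3) set" where
  "minor_arc A B = sgn ` closed_segment A B"

definition triangle_region :: "real^3 \<Rightarrow> real^3 \<Rightarrow> real^3 \<Rightarrow> (real^3) set" where
  "triangle_region A B C = sgn ` (convex hull {A, B, C})"

text \<open>A circle touches a side if it meets the great circle carrying that side in exactly one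
  point, and this point lies on the side.\<close>

definition tangent_to_side :: "(real^3) set \<Rightarrow> real^3 \<Rightarrow> real^3 \<Rightarrow> bool" where
  "tangent_to_side K A B \<longleftrightarrow>
     (\<exists>n p. n \<noteq> 0 \<and> {A, B} \<subseteq> great_circle n \<and> p \<in> minor_arc A B \<and> K \<inter> great_circle n = {p})"

definition circumradius :: "real^3 \<Rightarrow> real^3 \<Rightarrow> real^3 \<Rightarrow> real \<Rightarrow> bool" where
  "circumradius A B C R \<longleftrightarrow>
     0 < R \<and> R < pi / 2 \<and> (\<exists>P \<in> S2. {A, B, C} \<subseteq> scircle P R)"

definition inradius :: "real^3 \<Rightarrow> real^3 \<Rightarrow> real^3 \<Rightarrow> real \<Rightarrow> bool" where
  "inradius A B C r \<longleftrightarrow>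
     0 < r \<and> r < pi / 2 \<and>
     (\<exists>P \<in> S2. scircle P r \<subseteq> triangle_region A B C \<and>
        tangent_to_side (scircle P r) A B \<and>
        tangent_to_side (scircle P r) B C \<and>
        tangent_to_side (scircle P r) C A)"

end

theory Submission
  imports Defs
begin

text \<open>
  Write \<open>x = sin (a/2)\<close>, \<open>y = sin (b/2)\<close>, \<open>z = sin (c/2)\<close>; the chords spanned by the vertices have
  lengths \<open>2x\<close>, \<open>2y\<close>, \<open>2z\<close>. Let \<open>D\<close> be the determinant of the three vertices, and let \<open>s\<close> be half
  of the perimeter. The two centres are found by linear algebra. The circumcentre has the same
  inner product with all vertices, so it is a multiple of
  \<open>B \<times> C + C \<times> A + A \<times> B\<close>; the incentre has inner product \<open>sin r\<close> with the three
  inner unit normals of the sides, so it is a multiple of \<open>sin a A + sin b B + sin c C\<close>. Taking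
  norms gives \<open>tan R \<bar>D\<bar> = 4 x y z\<close> and \<open>2 tan r sin s = \<bar>D\<bar>\<close>
  (\<open>tan_circumradius\<close>, \<open>tan_inradius\<close>). As \<open>D\<^sup>2 = 4 sin s \<Pi>\<close> with
  \<open>\<Pi> = sin (s-a) sin (s-b) sin (s-c)\<close>, it follows that \<open>tan R / tan r = 2 x y z / \<Pi>\<close>.

  In the plane, the triangle with sides \<open>x, y, z\<close> has
  \<open>R / r = 2 x y z / ((y+z-x) (z+x-y) (x+y-z))\<close>. The spherical ratio is at least the
  planar one, because \<open>\<Pi> \<le> (y+z-x) (z+x-y) (x+y-z)\<close>
  (\<open>prod_sin_excess_le\<close>). The first two inequalities are thereby reduced to
  polynomial inequalities for plane triangles. The substitution \<open>x = v + w\<close>, \<open>y = w + u\<close>,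
  \<open>z = u + v\<close> turns them into Schur's inequality and the inequality between the arithmetic and
  geometric means of three numbers; the latter also yields the last two inequalities.
\<close>

section \<open>Polynomial inequalities for the sides of a plane triangle\<close>

lemma cyclic_amgm:
  fixes u v w :: real
  assumes "u \<ge> 0" "v \<ge> 0" "w \<ge> 0"
  shows "3 * u * v * w \<le> u\<^sup>2 * w + v\<^sup>2 * u + w\<^sup>2 * v"
proof -
  \<comment> \<open>Both sides are invariant under cyclic shifts, so one may assume that the last variable is the
     least.\<close>
  have least: "3 * u * v * w \<le> u\<^sup>2 * w + v\<^sup>2 * u + w\<^sup>2 * v"
    if "0 \<le> w" "w \<le> u" "w \<le> v" for u v w :: real
  proof -
    have "u\<^sup>2 * w + v\<^sup>2 * u + w\<^sup>2 * v - 3 * u * v * w = w * (u - v)\<^sup>2 + v * ((u - w) * (v - w))"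
      by (simp add: power2_eq_square algebra_simps)
    moreover have "0 \<le> w * (u - v)\<^sup>2 + v * ((u - w) * (v - w))"
      using that by simp
    ultimately show ?thesis by linarith
  qed
  consider "w \<le> u" "w \<le> v" | "u \<le> v" "u \<le> w" | "v \<le> w" "v \<le> u" by linarith
  then show ?thesis
    using least[of w u v] least[of u v w] least[of v w u] assms
    by cases (simp_all add: mult_ac add_ac)
qed

lemma schur:
  fixes u v w :: real
  assumes "u \<ge> 0" "v \<ge> 0" "w \<ge> 0"
  shows "0 \<le> u * (u - v) * (u - w) + v * (v - w) * (v - u) + w * (w - u) * (w - v)"
proof -
  have ordered: "0 \<le> u * (u - v) * (u - w) + v * (v - w) * (v - u) + w * (w - u) * (w - v)"
    if "w \<le> v" "v \<le> u" "0 \<le> w" for u v w :: real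
  proof -
    have "u * (u - v) * (u - w) + v * (v - w) * (v - u) + w * (w - u) * (w - v)
        = (u - v)\<^sup>2 * (u + v - w) + w * ((u - w) * (v - w))"
      by (simp add: power2_eq_square algebra_simps)
    then show ?thesis using that by simp
  qed
  have "w \<le> v \<and> v \<le> u \<or> w \<le> u \<and> u \<le> v \<or> u \<le> v \<and> v \<le> w \<or> u \<le> w \<and> w \<le> v
      \<or> v \<le> w \<and> w \<le> u \<or> v \<le> u \<and> u \<le> w" by linarith
  then show ?thesis
    using ordered[of w v u] ordered[of w u v] ordered[of u v w] ordered[of u w v]
      ordered[of v w u] ordered[of v u w] assms
    by (elim disjE) (simp_all add: algebra_simps)
qed

text \<open>In the variables \<open>u, v, w\<close> the difference of the two sides is four times the discriminant
  \<open>((u-v) (v-w) (w-u))\<^sup>2\<close> plus sixteen times the expression in Schur's inequality at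
  \<open>v w, w u, u v\<close>.\<close>

lemma planar_circumradius_inradius:
  fixes x y z :: real
  assumes "x \<le> y + z" "y \<le> z + x" "z \<le> x + y"
  shows "(y + z - x) * (z + x - y) * (x + y - z) * (x * y * z + x ^ 3 + y ^ 3 + z ^ 3)
    \<le> 4 * (x * y * z)\<^sup>2"
proof -
  define u v w where "u = (y + z - x) / 2" and "v = (z + x - y) / 2" and "w = (x + y - z) / 2"
  have nonneg: "0 \<le> u" "0 \<le> v" "0 \<le> w"
    using assms by (simp_all add: u_def v_def w_def)
  have sides: "x = v + w" "y = w + u" "z = u + v"
    by (simp_all add: u_def v_def w_def field_simps)
  let ?S = "\<lambda>u v w. u * (u - v) * (u - w) + v * (v - w) * (v - u) + w * (w - u) * (w - v)"
  have "4 * (x * y * z)\<^sup>2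
      - (y + z - x) * (z + x - y) * (x + y - z) * (x * y * z + x ^ 3 + y ^ 3 + z ^ 3)
    = 4 * ((u - v) * (v - w) * (w - u))\<^sup>2 + 16 * ?S (v * w) (w * u) (u * v)"
    unfolding sides by algebra
  moreover have "0 \<le> ?S (v * w) (w * u) (u * v)"
    by (rule schur) (use nonneg in simp_all)
  ultimately have "0 \<le> 4 * (x * y * z)\<^sup>2
      - (y + z - x) * (z + x - y) * (x + y - z) * (x * y * z + x ^ 3 + y ^ 3 + z ^ 3)"
    by (metis add_nonneg_nonneg mult_nonneg_nonneg zero_le_numeral zero_le_power2)
  then show ?thesis by simp
qed

text \<open>After the same substitution this is \<open>cyclic_amgm\<close>. The left side is not symmetric, so the
  inequality does not follow from Schur's inequality for \<open>x, y, z\<close>; the triangle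
  inequalities are what makes \<open>u, v, w\<close> nonnegative.\<close>

lemma planar_cyclic_bound:
  fixes x y z :: real
  assumes "x \<le> y + z" "y \<le> z + x" "z \<le> x + y"
  shows "2 * (x\<^sup>2 * z + y\<^sup>2 * x + z\<^sup>2 * y) \<le> x ^ 3 + y ^ 3 + z ^ 3 + 3 * (x * y * z)"
proof -
  define u v w where "u = (y + z - x) / 2" and "v = (z + x - y) / 2" and "w = (x + y - z) / 2"
  have nonneg: "0 \<le> u" "0 \<le> v" "0 \<le> w"
    using assms by (simp_all add: u_def v_def w_def)
  have sides: "x = v + w" "y = w + u" "z = u + v"
    by (simp_all add: u_def v_def w_def field_simps)
  have "x ^ 3 + y ^ 3 + z ^ 3 + 3 * (x * y * z) - 2 * (x\<^sup>2 * z + y\<^sup>2 * x + z\<^sup>2 * y)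
    = 2 * (u\<^sup>2 * w + v\<^sup>2 * u + w\<^sup>2 * v - 3 * u * v * w)"
    unfolding sides by algebra
  moreover have "0 \<le> 2 * (u\<^sup>2 * w + v\<^sup>2 * u + w\<^sup>2 * v - 3 * u * v * w)"
    using cyclic_amgm[OF nonneg] by simp
  ultimately show ?thesis by (metis diff_ge_0_iff_ge)
qed

section \<open>Half-angle trigonometry\<close>

lemma sin_add_mult_sin_diff:
  fixes p q :: real
  shows "sin (p + q) * sin (p - q) = (sin p)\<^sup>2 - (sin q)\<^sup>2"
proof -
  have "sin (p + q) * sin (p - q) = (sin p)\<^sup>2 * (cos q)\<^sup>2 - (cos p)\<^sup>2 * (sin q)\<^sup>2"
    by (simp add: sin_add sin_diff power2_eq_square algebra_simps)
  then show ?thesis by (simp add: cos_squared_eq algebra_simps)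
qed

text \<open>With \<open>\<delta> = (p - q)/2\<close>, the two sides are the squares of \<open>2 sin \<delta> cos ((p + q)/2)\<close> and
  \<open>2 sin \<delta> cos \<delta>\<close>, and \<open>\<bar>\<delta>\<bar> \<le> (p + q)/2 \<le> pi/2\<close>.\<close>

lemma sin_minus_sin_square_le:
  fixes p q :: real
  assumes "0 \<le> p" "p \<le> pi/2" "0 \<le> q" "q \<le> pi/2"
  shows "(sin p - sin q)\<^sup>2 \<le> (sin (p - q))\<^sup>2"
proof -
  have "cos ((p + q) / 2) \<le> cos \<bar>(p - q) / 2\<bar>"
    by (rule cos_monotone_0_pi_le) (use assms in auto)
  then have "cos ((p + q) / 2) \<le> cos ((p - q) / 2)" by (simp only: cos_abs_real)
  moreover have "0 \<le> cos ((p + q) / 2)"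
    by (rule cos_ge_zero) (use assms in auto)
  ultimately have "(cos ((p + q) / 2))\<^sup>2 \<le> (cos ((p - q) / 2))\<^sup>2"
    by (rule power_mono)
  then have "(2 * sin ((p - q) / 2))\<^sup>2 * (cos ((p + q) / 2))\<^sup>2
      \<le> (2 * sin ((p - q) / 2))\<^sup>2 * (cos ((p - q) / 2))\<^sup>2"
    by (rule mult_left_mono) simp
  moreover have "sin (p - q) = 2 * sin ((p - q) / 2) * cos ((p - q) / 2)"
    using sin_double[of "(p - q) / 2"] by (simp only: mult_2 field_sum_of_halves)
  ultimately show ?thesis
    by (simp add: sin_diff_sin power_mult_distrib)
qed

lemma sin_excess_mult_le:
  fixes p q t :: real
  assumes "0 \<le> p" "p \<le> pi/2" "0 \<le> q" "q \<le> pi/2"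
  shows "sin (t + p - q) * sin (t + q - p)
    \<le> (sin t + sin p - sin q) * (sin t + sin q - sin p)"
proof -
  have "sin (t + p - q) * sin (t + q - p) = (sin t)\<^sup>2 - (sin (p - q))\<^sup>2"
    using sin_add_mult_sin_diff[of t "p - q"] by (simp add: algebra_simps)
  also have "\<dots> \<le> (sin t)\<^sup>2 - (sin p - sin q)\<^sup>2"
    using sin_minus_sin_square_le[OF assms] by simp
  also have "\<dots> = (sin t + sin p - sin q) * (sin t + sin q - sin p)"
    by (simp add: power2_eq_square algebra_simps)
  finally show ?thesis .
qed

lemma sin_less_sin_add_sin:
  fixes p q t :: real
  assumes "0 < p" "p < pi/2" "0 < q" "q < pi/2" "0 < t" "t < pi/2" "t < p + q"
  shows "sin t < sin p + sin q"
proof (cases "p + q \<le> pi/2")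
  case True
  have pos: "0 < sin p" "0 < sin q" using assms by (auto intro!: sin_gt_zero)
  have "sin t \<le> sin (p + q)"
    using True assms by (intro sin_monotone_2pi_le) auto
  also have "\<dots> = sin p * cos q + cos p * sin q" by (rule sin_add)
  also have "\<dots> < sin p * 1 + 1 * sin q"
  proof -
    have "cos q < 1" "cos p < 1"
      using cos_monotone_0_pi[of 0 q] cos_monotone_0_pi[of 0 p] assms by auto
    with pos show ?thesis
      by (intro add_strict_mono mult_strict_left_mono mult_strict_right_mono)
  qed
  finally show ?thesis by simp
next
  case False
  \<comment> \<open>Here \<open>sin p > cos q\<close>, and \<open>sin q + cos q > 1\<close> for an acute angle.\<close>
  have "sin (pi/2 - q) < sin p"
    using False assms by (intro sin_monotone_2pi) auto
  then have "cos q < sin p" by (simp add: cos_sin_eq)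
  moreover have pos: "0 < sin q" "0 < cos q"
    using assms by (auto intro!: sin_gt_zero cos_gt_zero)
  have "1 \<le> (sin q + cos q)\<^sup>2"
    using pos sin_cos_squared_add[of q] by (simp add: power2_sum)
  then have "1 \<le> sin q + cos q"
    using pos by (smt (verit) power_le_one_iff abs_square_le_1 power2_le_imp_le one_power2)
  moreover have "sin t \<le> 1" by simp
  ultimately show ?thesis by linarith
qed

text \<open>A single factor on the left need not be at most its counterpart on the right, but by
  \<open>sin_excess_mult_le\<close> the product of any two is. Multiplying the three inequalities for
  pairs compares the squares of the full products.\<close>

lemma prod_sin_excess_le:
  fixes p q t :: real
  assumes bounds: "0 < p" "p < pi/2" "0 < q" "q < pi/2" "0 < t" "t < pi/2"
    and tri: "p < q + t" "q < t + p" "t < p + q"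
  shows "sin (q + t - p) * sin (t + p - q) * sin (p + q - t)
    \<le> (sin q + sin t - sin p) * (sin t + sin p - sin q) * (sin p + sin q - sin t)"
    (is "?s1 * ?s2 * ?s3 \<le> ?x1 * ?x2 * ?x3")
proof (rule power2_le_imp_le)
  have s: "0 < ?s1" "0 < ?s2" "0 < ?s3"
    using bounds tri by (auto intro!: sin_gt_zero)
  have x: "0 < ?x1" "0 < ?x2" "0 < ?x3"
    using sin_less_sin_add_sin[of q t p] sin_less_sin_add_sin[of t p q]
      sin_less_sin_add_sin[of p q t] bounds tri by auto
  have "?s2 * ?s1 \<le> ?x2 * ?x1"
    using sin_excess_mult_le[of p q t] bounds by (simp add: algebra_simps)
  moreover have "?s3 * ?s2 \<le> ?x3 * ?x2"
    using sin_excess_mult_le[of q t p] bounds by (simp add: algebra_simps)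
  moreover have "?s1 * ?s3 \<le> ?x1 * ?x3"
    using sin_excess_mult_le[of t p q] bounds by (simp add: algebra_simps)
  ultimately have "(?s2 * ?s1) * (?s3 * ?s2) * (?s1 * ?s3)
      \<le> (?x2 * ?x1) * (?x3 * ?x2) * (?x1 * ?x3)"
    using s x by (intro mult_mono[OF mult_mono]) (simp_all del: diff_gt_0_iff_gt)
  then show "(?s1 * ?s2 * ?s3)\<^sup>2 \<le> (?x1 * ?x2 * ?x3)\<^sup>2"
    by (simp only: power2_eq_square mult_ac)
  show "0 \<le> ?x1 * ?x2 * ?x3" using x by simp
qed

lemma gram_cos_factor:
  fixes a b c :: real
  shows "1 + 2 * cos a * cos b * cos c - (cos a)\<^sup>2 - (cos b)\<^sup>2 - (cos c)\<^sup>2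
    = (cos (a - b) - cos c) * (cos c - cos (a + b))"
proof -
  have "(cos (a - b) - cos c) * (cos c - cos (a + b))
      = (sin a)\<^sup>2 * (sin b)\<^sup>2 - (cos c - cos a * cos b)\<^sup>2"
    by (simp add: cos_add cos_diff power2_eq_square algebra_simps)
  also have "(sin a)\<^sup>2 * (sin b)\<^sup>2 = (1 - (cos a)\<^sup>2) * (1 - (cos b)\<^sup>2)"
    by (simp add: sin_squared_eq)
  finally show ?thesis by algebra
qed

lemma gram_cos_half_perimeter:
  fixes a b c :: real
  shows "1 + 2 * cos a * cos b * cos c - (cos a)\<^sup>2 - (cos b)\<^sup>2 - (cos c)\<^sup>2
    = 4 * sin ((a + b + c) / 2) *
      (sin (b/2 + c/2 - a/2) * sin (c/2 + a/2 - b/2) * sin (a/2 + b/2 - c/2))"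
proof -
  have "cos (a - b) - cos c = 2 * sin (c/2 + a/2 - b/2) * sin (b/2 + c/2 - a/2)"
    by (subst cos_diff_cos) (simp add: add_divide_distrib diff_divide_distrib algebra_simps)
  moreover have "cos c - cos (a + b) = 2 * sin ((a + b + c) / 2) * sin (a/2 + b/2 - c/2)"
    by (subst cos_diff_cos) (simp add: add_divide_distrib diff_divide_distrib algebra_simps)
  ultimately show ?thesis
    unfolding gram_cos_factor by simp
qed

text \<open>The hypothesis on the Gram determinant of the vertices says that
  \<open>sin\<^sup>2 a sin\<^sup>2 b - (cos c - cos a cos b)\<^sup>2\<close> is positive. This holds only if \<open>cos c\<close> lies strictly
  between \<open>cos (a + b)\<close> and \<open>cos (a - b)\<close>; monotonicity of the cosine on \<open>[0, pi]\<close> then bounds \<open>c\<close>.\<close>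

lemma spherical_triangle_inequalities:
  fixes a b c :: real
  assumes range: "0 \<le> a" "a \<le> pi" "0 \<le> b" "b \<le> pi" "0 \<le> c" "c \<le> pi"
    and gram: "0 < 1 + 2 * cos a * cos b * cos c - (cos a)\<^sup>2 - (cos b)\<^sup>2 - (cos c)\<^sup>2"
  shows "a < b + c" "b < c + a" "c < a + b" "a + b + c < 2 * pi"
proof -
  have prod: "0 < (cos (a - b) - cos c) * (cos c - cos (a + b))"
    using gram unfolding gram_cos_factor .
  have "0 \<le> sin a * sin b" using range by (simp add: sin_ge_zero)
  then have "cos (a + b) \<le> cos (a - b)" by (simp add: cos_add cos_diff)
  with prod have less: "cos c < cos (a - b)" "cos (a + b) < cos c"
    by (auto simp: zero_less_mult_iff)
  have "\<bar>a - b\<bar> < c"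
  proof (rule ccontr)
    assume "\<not> ?thesis"
    then have "cos \<bar>a - b\<bar> \<le> cos c" using range by (intro cos_monotone_0_pi_le) auto
    with less show False by simp
  qed
  then show "a < b + c" "b < c + a" by auto
  show "c < a + b"
  proof (rule ccontr)
    assume "\<not> ?thesis"
    then have "cos c \<le> cos (a + b)" using range by (intro cos_monotone_0_pi_le) auto
    with less show False by simp
  qed
  show "a + b + c < 2 * pi"
  proof (rule ccontr)
    assume "\<not> ?thesis"
    then have "cos c \<le> cos (2 * pi - (a + b))"
      using range by (intro cos_monotone_0_pi_le) auto
    with less show False by (simp add: cos_diff)
  qed
qed

section \<open>The determinant of the vertices\<close>

unbundle cross3_syntax

abbreviation triple :: "real^3 \<Rightarrow> real^3 \<Rightarrow> real^3 \<Rightarrow> real" where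
  "triple A B C \<equiv> A \<bullet> (B \<times> C)"

lemma triple_rotate: "triple B C A = triple A B C"
  by (simp add: cross3_simps)

lemma triple_square_gram:
  "(triple A B C)\<^sup>2 = (A \<bullet> A) * (B \<bullet> B) * (C \<bullet> C) + 2 * (B \<bullet> C) * (C \<bullet> A) * (A \<bullet> B)
    - (A \<bullet> A) * (B \<bullet> C)\<^sup>2 - (B \<bullet> B) * (C \<bullet> A)\<^sup>2 - (C \<bullet> C) * (A \<bullet> B)\<^sup>2"
  unfolding inner_vec_def sum_3 cross_components inner_real_def by algebra

text \<open>Cramer's rule for the basis of the vertices and, below, for the basis of the side normals, which
  is dual to it up to the factor \<open>triple A B C\<close>. The equations of the incentre prescribe inner
  products with the normals, those of the circumcentre prescribe inner products with the vertices.\<close>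

lemma expand_in_vertices:
  "triple A B C *\<^sub>R P = triple P B C *\<^sub>R A + triple P C A *\<^sub>R B + triple P A B *\<^sub>R C"
  unfolding vec_eq_iff forall_3 vector_add_component vector_scaleR_component
    inner_vec_def sum_3 cross_components inner_real_def real_scaleR_def
  by algebra

lemma expand_in_normals:
  "triple A B C *\<^sub>R P = (P \<bullet> A) *\<^sub>R (B \<times> C) + (P \<bullet> B) *\<^sub>R (C \<times> A) + (P \<bullet> C) *\<^sub>R (A \<times> B)"
  unfolding vec_eq_iff forall_3 vector_add_component vector_scaleR_component
    inner_vec_def sum_3 cross_components inner_real_def real_scaleR_def
  by algebra

lemma sdist_S2:
  assumes "x \<in> S2" "y \<in> S2"
  shows "cos (sdist x y) = x \<bullet> y" "0 \<le> sdist x y" "sdist x y \<le> pi"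
proof -
  have "\<bar>x \<bullet> y\<bar> \<le> 1"
    using Cauchy_Schwarz_ineq2[of x y] assms by simp
  then show "cos (sdist x y) = x \<bullet> y" "0 \<le> sdist x y" "sdist x y \<le> pi"
    by (auto simp: sdist_def arccos_lbound arccos_ubound)
qed

lemma triple_nonzero:
  assumes "spherical_triangle A B C"
  shows "triple A B C \<noteq> 0"
proof
  assume "triple A B C = 0"
  then have "det (vector [A, B, C] :: real^3^3) = 0"
    by (simp add: dot_cross_det)
  then have "\<not> invertible (vector [A, B, C] :: real^3^3)"
    by (simp add: invertible_det_nz)
  then obtain n where n: "n \<noteq> 0" "(vector [A, B, C] :: real^3^3) *v n = 0"
    using matrix_left_invertible_ker[of "vector [A, B, C] :: real^3^3"]
    by (auto simp: invertible_left_inverse)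
  then have "A \<bullet> n = 0" "B \<bullet> n = 0" "C \<bullet> n = 0"
    by (simp_all add: vec_eq_iff forall_3 matrix_vector_mul_component vector_3)
  then show False
    using assms n(1) by (auto simp: spherical_triangle_def great_circle_def inner_commute)
qed

section \<open>The circumscribed circle\<close>

text \<open>The direction of the circumcentre is \<open>N = B \<times> C + C \<times> A + A \<times> B\<close>, a normal of the
  plane through the vertices. Its squared norm exceeds \<open>(triple A B C)\<^sup>2\<close> exactly by the right
  side, which is \<open>16 sin\<^sup>2 (a/2) sin\<^sup>2 (b/2) sin\<^sup>2 (c/2)\<close> in terms of the sides.\<close>

lemma tan_circumradius:
  assumes tri: "spherical_triangle A B C" and circ: "circumradius A B C R"
  shows "(tan R)\<^sup>2 * (triple A B C)\<^sup>2 = 2 * (1 - B \<bullet> C) * (1 - C \<bullet> A) * (1 - A \<bullet> B)"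
proof -
  let ?D = "triple A B C"
  obtain P where R: "0 < R" "R < pi / 2" and P: "P \<in> S2" "{A, B, C} \<subseteq> scircle P R"
    using circ by (auto simp: circumradius_def)
  have unit: "A \<bullet> A = 1" "B \<bullet> B = 1" "C \<bullet> C = 1" "P \<bullet> P = 1"
    using tri P(1) by (auto simp: spherical_triangle_def norm_eq_1)
  have PX: "P \<bullet> X = cos R" if "X \<in> {A, B, C}" for X
  proof -
    have "X \<in> S2" "sdist P X = R" using P(2) that by (auto simp: scircle_def)
    then show ?thesis using sdist_S2(1)[OF P(1)] by metis
  qed
  let ?N = "B \<times> C + C \<times> A + A \<times> B"
  have "?D *\<^sub>R P = cos R *\<^sub>R ?N"
    using expand_in_normals[of A B C P] PX by (simp add: scaleR_add_right)
  then have "(?D *\<^sub>R P) \<bullet> (?D *\<^sub>R P) = (cos R *\<^sub>R ?N) \<bullet> (cos R *\<^sub>R ?N)" by simp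
  then have D: "?D\<^sup>2 = (cos R)\<^sup>2 * (?N \<bullet> ?N)"
    using unit by (simp add: power2_eq_square)
  have gram: "?D\<^sup>2 = 1 + 2 * (B \<bullet> C) * (C \<bullet> A) * (A \<bullet> B) - (B \<bullet> C)\<^sup>2 - (C \<bullet> A)\<^sup>2 - (A \<bullet> B)\<^sup>2"
    unfolding triple_square_gram unit by simp
  have N: "?N \<bullet> ?N = ?D\<^sup>2 + 2 * (1 - B \<bullet> C) * (1 - C \<bullet> A) * (1 - A \<bullet> B)"
    unfolding gram
    by (simp add: inner_add_left inner_add_right dot_cross unit inner_commute
        power2_eq_square algebra_simps)
  have "cos R \<noteq> 0" using R cos_gt_zero[of R] by simp
  then have tan2: "(tan R)\<^sup>2 * (cos R)\<^sup>2 = 1 - (cos R)\<^sup>2"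
    by (simp add: tan_def power_divide sin_squared_eq)
  have "(tan R)\<^sup>2 * ?D\<^sup>2 = (1 - (cos R)\<^sup>2) * (?N \<bullet> ?N)"
    unfolding tan2[symmetric] by (simp add: D)
  also have "\<dots> = ?N \<bullet> ?N - ?D\<^sup>2" by (simp add: D algebra_simps)
  finally show ?thesis using N by simp
qed

section \<open>The inscribed circle\<close>

text \<open>The reflection in the plane spanned by the pole and \<open>P\<close> preserves both the circle and the great
  circle. The unique common point is therefore fixed by it, so it is the point of the great circle
  nearest to \<open>P\<close>; its distance \<open>r\<close> from \<open>P\<close> is thus complementary to the angle between
  \<open>P\<close> and the pole or its antipode.\<close>

lemma tangent_great_circle:
  assumes P: "P \<in> S2" and r: "0 < r" "r < pi / 2" and n: "n \<noteq> 0"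
    and tangent: "scircle P r \<inter> great_circle n = {p}"
  shows "(n \<bullet> P)\<^sup>2 = (sin r)\<^sup>2 * (n \<bullet> n)"
proof -
  define m where "m = n \<bullet> n"
  have m: "m > 0" using n by (simp add: m_def)
  have unitP: "P \<bullet> P = 1" using P by (simp add: norm_eq_1)
  have p: "p \<in> S2" "sdist P p = r" "n \<bullet> p = 0"
    using tangent by (auto simp: scircle_def great_circle_def)
  have unitp: "p \<bullet> p = 1" using p(1) by (simp add: norm_eq_1)
  have Pp: "P \<bullet> p = cos r" using sdist_S2(1)[OF P p(1)] p(2) by simp
  have cosr: "cos r > 0" using r cos_gt_zero by simp
  \<comment> \<open>\<open>Q\<close> is \<open>m\<close> times the projection of \<open>P\<close> to the plane of the great circle, and \<open>p'\<close> is the mirror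
     image of \<open>p\<close> in the line through \<open>Q\<close>.\<close>
  define Q where "Q = m *\<^sub>R P - (n \<bullet> P) *\<^sub>R n"
  have nQ: "n \<bullet> Q = 0" by (simp add: Q_def m_def inner_diff_right inner_commute)
  have pQ: "p \<bullet> Q = m * cos r"
    using p(3) Pp by (simp add: Q_def inner_diff_right inner_commute)
  have PQ: "P \<bullet> Q = m - (n \<bullet> P)\<^sup>2"
    by (simp add: Q_def inner_diff_right unitP inner_commute power2_eq_square)
  have QQ: "Q \<bullet> Q = m * (P \<bullet> Q)"
    using nQ by (subst (1) Q_def) (simp add: inner_diff_left)
  have QQ0: "Q \<bullet> Q \<noteq> 0" using pQ m cosr by auto
  define k where "k = 2 * (p \<bullet> Q) / (Q \<bullet> Q)"
  define p' where "p' = k *\<^sub>R Q - p"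
  have kQQ: "k * (Q \<bullet> Q) = 2 * (p \<bullet> Q)" using QQ0 by (simp add: k_def)
  have "p' \<bullet> p' = k * (k * (Q \<bullet> Q)) - 2 * k * (p \<bullet> Q) + p \<bullet> p"
    by (simp add: p'_def inner_diff_left inner_diff_right inner_commute algebra_simps)
  also have "\<dots> = 1" unfolding kQQ using unitp by simp
  finally have p'_unit: "p' \<in> S2" by (simp add: norm_eq_1)
  have "n \<bullet> p' = 0" using nQ p(3) by (simp add: p'_def inner_diff_right)
  moreover have "P \<bullet> p' = cos r"
  proof -
    have "m * (P \<bullet> p') = k * (Q \<bullet> Q) - m * (P \<bullet> p)"
      by (simp add: p'_def inner_diff_right QQ algebra_simps)
    also have "\<dots> = m * cos r" unfolding kQQ pQ Pp by simp
    finally show ?thesis using m by simp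
  qed
  then have "sdist P p' = r"
    using r by (simp add: sdist_def arccos_cos)
  ultimately have "p' \<in> scircle P r \<inter> great_circle n"
    using p'_unit by (simp add: scircle_def great_circle_def)
  then have "p' = p" using tangent by simp
  then have "2 *\<^sub>R p = k *\<^sub>R Q"
    by (simp add: p'_def scaleR_2 algebra_simps)
  then have "p \<bullet> (2 *\<^sub>R p) = p \<bullet> (k *\<^sub>R Q)" by simp
  then have "2 = k * (p \<bullet> Q)" using unitp by simp
  then have "2 * (Q \<bullet> Q) = 2 * (p \<bullet> Q)\<^sup>2"
    using kQQ by algebra
  then have "m * (m - (n \<bullet> P)\<^sup>2) = m * (m * (cos r)\<^sup>2)"
    using QQ PQ pQ by (simp add: power2_eq_square algebra_simps)
  then have "m - (n \<bullet> P)\<^sup>2 = m * (cos r)\<^sup>2" using m by simp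
  then show ?thesis
    by (simp add: sin_squared_eq m_def algebra_simps)
qed

text \<open>Tangency comes with an arbitrary pole \<open>n\<close> of the side. It is parallel to \<open>A \<times> B\<close>, so the
  squared cosines of their angles with \<open>P\<close> agree.\<close>

lemma parallel_cross:
  assumes "n \<bullet> A = 0" "n \<bullet> B = 0"
  shows "(A \<times> B) \<bullet> (A \<times> B) * (n \<bullet> P)\<^sup>2 = (triple P A B)\<^sup>2 * (n \<bullet> n)"
proof -
  have "n \<times> (A \<times> B) = 0" using assms by (simp add: Lagrange)
  moreover have "P \<times> (n \<times> (A \<times> B)) = (P \<bullet> (A \<times> B)) *\<^sub>R n - (P \<bullet> n) *\<^sub>R (A \<times> B)"
    by (rule Lagrange)
  ultimately have "(P \<bullet> (A \<times> B)) *\<^sub>R n = (P \<bullet> n) *\<^sub>R (A \<times> B)" by simp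
  then have "((P \<bullet> (A \<times> B)) *\<^sub>R n) \<bullet> ((P \<bullet> (A \<times> B)) *\<^sub>R n)
      = ((P \<bullet> n) *\<^sub>R (A \<times> B)) \<bullet> ((P \<bullet> n) *\<^sub>R (A \<times> B))" by simp
  then show ?thesis by (simp add: power2_eq_square inner_commute mult_ac)
qed

lemma triangle_region_side:
  assumes "x \<in> triangle_region A B C"
  shows "0 \<le> triple A B C * triple x A B" "0 \<le> triple A B C * triple x B C"
    "0 \<le> triple A B C * triple x C A"
proof -
  obtain u v w where uvw: "0 \<le> u" "0 \<le> v" "0 \<le> w"
    and x: "x = sgn (u *\<^sub>R A + v *\<^sub>R B + w *\<^sub>R C)" (is "x = sgn ?y")
    using assms unfolding triangle_region_def convex_hull_3 by auto
  have y: "triple ?y A B = w * triple A B C" "triple ?y B C = u * triple A B C"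
    "triple ?y C A = v * triple A B C"
    using triple_rotate[of A B C] triple_rotate[of B C A]
    by (simp_all add: inner_add_left dot_cross_self)
  show "0 \<le> triple A B C * triple x A B" "0 \<le> triple A B C * triple x B C"
    "0 \<le> triple A B C * triple x C A"
    using uvw by (simp_all add: x sgn_div_norm y mult.left_commute[of "triple A B C"])
qed

text \<open>A circle is symmetric about its centre, so the centre is a positive multiple of the midpoint of
  two points of the circle, and it lies in every closed half-space through the origin that
  contains the circle.\<close>

lemma centre_in_half_space:
  assumes P: "P \<in> S2" and r: "0 < r" "r < pi / 2" and x: "x \<in> scircle P r"
    and half: "\<And>y. y \<in> scircle P r \<Longrightarrow> 0 \<le> y \<bullet> h"
  shows "0 \<le> P \<bullet> h"
proof -
  have xS: "x \<in> S2" and "sdist P x = r" using x by (auto simp: scircle_def)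
  then have Px: "P \<bullet> x = cos r" using sdist_S2(1)[OF P] by metis
  define x' where "x' = (2 * cos r) *\<^sub>R P - x"
  have unit: "P \<bullet> P = 1" "x \<bullet> x = 1" using P xS by (simp_all add: norm_eq_1)
  have "x' \<bullet> x' = 1" "P \<bullet> x' = cos r"
    using Px unit by (simp_all add: x'_def inner_diff_left inner_diff_right inner_commute)
  then have "x' \<in> scircle P r"
    using r by (simp add: scircle_def norm_eq_1 sdist_def arccos_cos)
  then have "0 \<le> x' \<bullet> h" "0 \<le> x \<bullet> h" using half x by auto
  then have "0 \<le> 2 * cos r * (P \<bullet> h)"
    by (simp add: x'_def inner_diff_left)
  moreover have "0 < cos r" using r cos_gt_zero by simp
  ultimately show ?thesis by (simp add: zero_le_mult_iff)
qed

text \<open>Tangency determines the inner product of the centre with the side normal up to sign, and the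
  half-space containing the circle determines the sign.\<close>

lemma incentre_side:
  assumes P: "P \<in> S2" and r: "0 < r" "r < pi / 2" and AB: "A \<in> S2" "B \<in> S2"
    and tangent: "tangent_to_side (scircle P r) A B"
    and side: "\<And>x. x \<in> scircle P r \<Longrightarrow> 0 \<le> \<sigma> * triple x A B"
    and \<sigma>: "\<bar>\<sigma>\<bar> = 1"
  shows "\<sigma> * triple P A B = sin r * sin (sdist A B)"
proof -
  obtain n p where n: "n \<noteq> 0" "{A, B} \<subseteq> great_circle n"
    and p: "scircle P r \<inter> great_circle n = {p}"
    using tangent by (auto simp: tangent_to_side_def)
  have nAB: "n \<bullet> A = 0" "n \<bullet> B = 0" using n(2) by (auto simp: great_circle_def)
  have unit: "A \<bullet> A = 1" "B \<bullet> B = 1" using AB by (simp_all add: norm_eq_1)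
  have "(A \<times> B) \<bullet> (A \<times> B) = 1 - (A \<bullet> B)\<^sup>2"
    by (simp add: dot_cross unit inner_commute power2_eq_square)
  also have "\<dots> = (sin (sdist A B))\<^sup>2"
    using sdist_S2(1)[OF AB] by (simp add: sin_squared_eq)
  finally have cross: "(A \<times> B) \<bullet> (A \<times> B) = (sin (sdist A B))\<^sup>2" .
  have "(triple P A B)\<^sup>2 * (n \<bullet> n) = (sin (sdist A B))\<^sup>2 * ((sin r)\<^sup>2 * (n \<bullet> n))"
    using parallel_cross[OF nAB, of P]
    unfolding cross tangent_great_circle[OF P r n(1) p] by (rule sym)
  then have "(triple P A B)\<^sup>2 = (sin r * sin (sdist A B))\<^sup>2"
    by (metis (no_types) n(1) inner_eq_zero_iff mult.assoc mult.commute mult_cancel_right power_mult_distrib)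
  moreover have "\<sigma>\<^sup>2 = 1" using \<sigma> by (metis power2_abs one_power2)
  ultimately have "(\<sigma> * triple P A B)\<^sup>2 = (sin r * sin (sdist A B))\<^sup>2"
    by (simp add: power_mult_distrib)
  moreover have "0 \<le> P \<bullet> (\<sigma> *\<^sub>R (A \<times> B))"
    by (rule centre_in_half_space[OF P r, of p]) (use p side in auto)
  then have "0 \<le> \<sigma> * triple P A B" by simp
  moreover have "0 \<le> sin r * sin (sdist A B)"
    using r sdist_S2(2,3)[OF AB] by (simp add: sin_ge_zero)
  ultimately show ?thesis by (simp add: power2_eq_iff_nonneg)
qed

lemma norm_incentre_direction:
  fixes a b c :: real
  shows "(sin a)\<^sup>2 + (sin b)\<^sup>2 + (sin c)\<^sup>2 + 2 * (sin b * sin c * cos a)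
      + 2 * (sin c * sin a * cos b) + 2 * (sin a * sin b * cos c)
    = 1 + 2 * cos a * cos b * cos c - (cos a)\<^sup>2 - (cos b)\<^sup>2 - (cos c)\<^sup>2
      + 4 * (sin ((a + b + c) / 2))\<^sup>2"
proof -
  have "cos (a + b + c) = 1 - 2 * (sin ((a + b + c) / 2))\<^sup>2"
    using cos_double_sin[of "(a + b + c) / 2"]
    by (simp only: mult_2[of "(a + b + c) / 2"] field_sum_of_halves)
  then have "4 * (sin ((a + b + c) / 2))\<^sup>2 = 2 - 2 * cos (a + b + c)" by simp
  also have "cos (a + b + c) = cos a * cos b * cos c - sin a * sin b * cos c
      - sin a * cos b * sin c - cos a * sin b * sin c"
    by (simp add: cos_add sin_add algebra_simps)
  finally show ?thesis by (simp add: sin_squared_eq algebra_simps)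
qed

text \<open>The direction of the incentre is \<open>V = sin a A + sin b B + sin c C\<close>, and the lemma above computes
  how far its squared norm exceeds \<open>(triple A B C)\<^sup>2\<close>.\<close>

lemma tan_inradius:
  assumes tri: "spherical_triangle A B C" and inr: "inradius A B C r"
    and abc: "a = sdist B C" "b = sdist C A" "c = sdist A B"
  shows "(tan r)\<^sup>2 * (2 * sin ((a + b + c) / 2))\<^sup>2 = (triple A B C)\<^sup>2"
proof -
  let ?D = "triple A B C"
  obtain P where r: "0 < r" "r < pi / 2" and P: "P \<in> S2"
    and reg: "scircle P r \<subseteq> triangle_region A B C"
    and tangent: "tangent_to_side (scircle P r) A B" "tangent_to_side (scircle P r) B C"
      "tangent_to_side (scircle P r) C A"
    using inr by (auto simp: inradius_def)
  have S: "A \<in> S2" "B \<in> S2" "C \<in> S2" using tri by (auto simp: spherical_triangle_def)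
  have unit: "A \<bullet> A = 1" "B \<bullet> B = 1" "C \<bullet> C = 1" "P \<bullet> P = 1"
    using S P by (simp_all add: norm_eq_1)
  \<comment> \<open>The sign of the determinant makes the argument independent of the orientation.\<close>
  have D0: "?D \<noteq> 0" using triple_nonzero[OF tri] .
  have sgnD: "\<bar>sgn ?D\<bar> = 1" using D0 by (simp add: sgn_if)
  have side: "0 \<le> sgn ?D * triple x A B" "0 \<le> sgn ?D * triple x B C" "0 \<le> sgn ?D * triple x C A"
    if "x \<in> scircle P r" for x
    using triangle_region_side[of x A B C] reg that D0
    by (auto simp: sgn_if zero_le_mult_iff)
  have PAB: "sgn ?D * triple P A B = sin r * sin c"
    unfolding abc using side(1) by (intro incentre_side[OF P r S(1,2) tangent(1) _ sgnD])
  have PBC: "sgn ?D * triple P B C = sin r * sin a"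
    unfolding abc using side(2) by (intro incentre_side[OF P r S(2,3) tangent(2) _ sgnD])
  have PCA: "sgn ?D * triple P C A = sin r * sin b"
    unfolding abc using side(3) by (intro incentre_side[OF P r S(3,1) tangent(3) _ sgnD])
  let ?V = "sin a *\<^sub>R A + sin b *\<^sub>R B + sin c *\<^sub>R C"
  have "\<bar>?D\<bar> *\<^sub>R P = sgn ?D *\<^sub>R (?D *\<^sub>R P)"
    by (simp add: abs_sgn mult.commute)
  also have "\<dots> = (sgn ?D * triple P B C) *\<^sub>R A + (sgn ?D * triple P C A) *\<^sub>R B
      + (sgn ?D * triple P A B) *\<^sub>R C"
    by (subst expand_in_vertices) (simp add: scaleR_add_right)
  also have "\<dots> = sin r *\<^sub>R ?V"
    unfolding PAB PBC PCA by (simp add: scaleR_add_right)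
  finally have "(\<bar>?D\<bar> *\<^sub>R P) \<bullet> (\<bar>?D\<bar> *\<^sub>R P) = (sin r *\<^sub>R ?V) \<bullet> (sin r *\<^sub>R ?V)" by simp
  then have D: "?D\<^sup>2 = (sin r)\<^sup>2 * (?V \<bullet> ?V)"
    using unit by (simp add: power2_eq_square)
  have cosines: "B \<bullet> C = cos a" "C \<bullet> A = cos b" "A \<bullet> B = cos c"
    using S by (simp_all add: abc sdist_S2)
  then have sym: "C \<bullet> B = cos a" "A \<bullet> C = cos b" "B \<bullet> A = cos c"
    by (simp_all add: inner_commute)
  have gram: "?D\<^sup>2 = 1 + 2 * cos a * cos b * cos c - (cos a)\<^sup>2 - (cos b)\<^sup>2 - (cos c)\<^sup>2"
    unfolding triple_square_gram unit cosines by simp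
  have "?V \<bullet> ?V = (sin a)\<^sup>2 + (sin b)\<^sup>2 + (sin c)\<^sup>2 + 2 * (sin b * sin c * cos a)
      + 2 * (sin c * sin a * cos b) + 2 * (sin a * sin b * cos c)"
    by (simp add: inner_add_left inner_add_right unit cosines sym power2_eq_square algebra_simps)
  then have V: "?V \<bullet> ?V = ?D\<^sup>2 + (2 * sin ((a + b + c) / 2))\<^sup>2"
    unfolding norm_incentre_direction gram by (simp add: power_mult_distrib)
  have "0 < cos r" using r cos_gt_zero by simp
  then have tan2: "(tan r)\<^sup>2 * (cos r)\<^sup>2 = (sin r)\<^sup>2"
    by (simp add: tan_def power_divide)
  have "(2 * sin ((a + b + c) / 2))\<^sup>2 = (cos r)\<^sup>2 * (?V \<bullet> ?V)"
    unfolding cos_squared_eq using V D by (simp only: left_diff_distrib)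
  then show ?thesis using D tan2 by (simp add: mult.assoc[symmetric])
qed

section \<open>The chain of inequalities\<close>

lemma tan_circumradius_div_tan_inradius:
  assumes tri: "spherical_triangle A B C"
    and abc: "a = sdist B C" "b = sdist C A" "c = sdist A B"
    and circ: "circumradius A B C R" and inr: "inradius A B C r"
  shows "tan R / tan r = 2 * (sin (a/2) * sin (b/2) * sin (c/2)) /
      (sin (b/2 + c/2 - a/2) * sin (c/2 + a/2 - b/2) * sin (a/2 + b/2 - c/2))" (is "_ = 2 * ?q / ?p")
    and "0 < a" "a < pi" "0 < b" "b < pi" "0 < c" "c < pi"
    and "a < b + c" "b < c + a" "c < a + b"
proof -
  let ?D = "triple A B C" and ?s = "sin ((a + b + c) / 2)"
  have S: "A \<in> S2" "B \<in> S2" "C \<in> S2" using tri by (auto simp: spherical_triangle_def)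
  have unit: "A \<bullet> A = 1" "B \<bullet> B = 1" "C \<bullet> C = 1" using S by (simp_all add: norm_eq_1)
  have cosines: "B \<bullet> C = cos a" "C \<bullet> A = cos b" "A \<bullet> B = cos c"
    using S by (simp_all add: abc sdist_S2)
  have range: "0 \<le> a" "a \<le> pi" "0 \<le> b" "b \<le> pi" "0 \<le> c" "c \<le> pi"
    using S by (simp_all add: abc sdist_S2)
  have D0: "0 < ?D\<^sup>2" using triple_nonzero[OF tri] by simp
  have gram: "?D\<^sup>2 = 1 + 2 * cos a * cos b * cos c - (cos a)\<^sup>2 - (cos b)\<^sup>2 - (cos c)\<^sup>2"
    unfolding triple_square_gram unit cosines by simp
  note triangle = spherical_triangle_inequalities[OF range D0[unfolded gram]]
  show "a < b + c" "b < c + a" "c < a + b" by (fact triangle)+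
  show pos: "0 < a" "0 < b" "0 < c" and lt: "a < pi" "b < pi" "c < pi"
    using triangle by linarith+
  have s: "0 < ?s" using pos triangle by (intro sin_gt_zero) auto
  have q: "0 < ?q" using pos lt by (simp add: sin_gt_zero)
  have R: "0 < tan R" using circ by (auto simp: circumradius_def intro: tan_gt_zero)
  have r: "0 < tan r" using inr by (auto simp: inradius_def intro: tan_gt_zero)
  have half: "1 - cos t = 2 * (sin (t/2))\<^sup>2" for t :: real
    using cos_double_sin[of "t/2"] by simp
  have "(tan R * \<bar>?D\<bar>)\<^sup>2 = (4 * ?q)\<^sup>2"
    using tan_circumradius[OF tri circ]
    unfolding cosines half by (simp add: power_mult_distrib)
  then have DR: "tan R * \<bar>?D\<bar> = 4 * ?q"
    using R q by (subst (asm) power2_eq_iff_nonneg) auto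
  have "(tan r * (2 * ?s))\<^sup>2 = \<bar>?D\<bar>\<^sup>2"
    using tan_inradius[OF tri inr abc] by (simp add: power_mult_distrib)
  then have Dr: "tan r * (2 * ?s) = \<bar>?D\<bar>"
    using r s by (subst (asm) power2_eq_iff_nonneg) auto
  have D2: "?D\<^sup>2 = 4 * ?s * ?p" unfolding gram by (rule gram_cos_half_perimeter)
  then have p: "0 < ?p" using D0 s by (simp add: zero_less_mult_iff)
  have "\<bar>?D\<bar> * (tan r * (2 * ?s)) = 4 * ?s * ?p"
    using D2 Dr by (simp add: power2_eq_square)
  then have "(2 * ?s) * (\<bar>?D\<bar> * tan r) = (2 * ?s) * (2 * ?p)" by (simp add: mult_ac)
  then have "\<bar>?D\<bar> * tan r = 2 * ?p"
    using s by (metis mult_cancel_left less_numeral_extra(3) mult_pos_pos zero_less_numeral)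
  then have "\<bar>?D\<bar> * (tan R * ?p) = \<bar>?D\<bar> * (2 * ?q * tan r)"
    using DR by algebra
  then have "tan R * ?p = 2 * ?q * tan r" using D0 by simp
  then show "tan R / tan r = 2 * ?q / ?p"
    using p r by (subst frac_eq_eq) auto
qed

theorem theorem3p1:
  fixes A B C :: "real^3" and a b c R r :: real
  assumes "spherical_triangle A B C"
    and "a = sdist B C" and "b = sdist C A" and "c = sdist A B"
    and "circumradius A B C R"
    and "inradius A B C r"
  shows "tan R / tan r \<ge>
      (sin (a/2) * sin (b/2) * sin (c/2) + sin (a/2) ^ 3 + sin (b/2) ^ 3 + sin (c/2) ^ 3)
        / (2 * sin (a/2) * sin (b/2) * sin (c/2))
    \<and> (sin (a/2) * sin (b/2) * sin (c/2) + sin (a/2) ^ 3 + sin (b/2) ^ 3 + sin (c/2) ^ 3)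
        / (2 * sin (a/2) * sin (b/2) * sin (c/2))
      \<ge> sin (a/2) / sin (b/2) + sin (b/2) / sin (c/2) + sin (c/2) / sin (a/2) - 1
    \<and> sin (a/2) / sin (b/2) + sin (b/2) / sin (c/2) + sin (c/2) / sin (a/2) - 1
      \<ge> 2/3 * (sin (a/2) / sin (b/2) + sin (b/2) / sin (c/2) + sin (c/2) / sin (a/2))
    \<and> 2/3 * (sin (a/2) / sin (b/2) + sin (b/2) / sin (c/2) + sin (c/2) / sin (a/2)) \<ge> 2"
proof -
  note triangle = tan_circumradius_div_tan_inradius[OF assms]
  define x y z where "x = sin (a/2)" and "y = sin (b/2)" and "z = sin (c/2)"
  have pos: "0 < x" "0 < y" "0 < z"
    using triangle(2-7) by (auto simp: x_def y_def z_def intro!: sin_gt_zero)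
  have planar: "x < y + z" "y < z + x" "z < x + y"
    unfolding x_def y_def z_def using triangle(2-)
    by (auto intro!: sin_less_sin_add_sin)
  define q where "q = x * y * z"
  define p where "p = sin (b/2 + c/2 - a/2) * sin (c/2 + a/2 - b/2) * sin (a/2 + b/2 - c/2)"
  define T where "T = x / y + y / z + z / x"
  have q: "0 < q" using pos by (simp add: q_def)
  have p: "0 < p"
    using triangle(2-) by (auto simp: p_def intro!: mult_pos_pos sin_gt_zero)
  have ratio: "tan R / tan r = 2 * q / p"
    using triangle(1) by (simp add: p_def q_def x_def y_def z_def)
  have sum: "0 < q + x ^ 3 + y ^ 3 + z ^ 3" using q pos by (simp add: add_pos_pos)

  have "p \<le> (y + z - x) * (z + x - y) * (x + y - z)"
    unfolding p_def x_def y_def z_def using triangle(2-)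
    by (intro prod_sin_excess_le) auto
  then have "p * (q + x ^ 3 + y ^ 3 + z ^ 3)
      \<le> (y + z - x) * (z + x - y) * (x + y - z) * (q + x ^ 3 + y ^ 3 + z ^ 3)"
    using sum by (intro mult_right_mono) auto
  also have "\<dots> \<le> 4 * q\<^sup>2"
    unfolding q_def using planar by (intro planar_circumradius_inradius) auto
  finally have first: "(q + x ^ 3 + y ^ 3 + z ^ 3) / (2 * q) \<le> tan R / tan r"
    unfolding ratio using p q by (simp add: field_simps power2_eq_square)

  have T: "T * q = x\<^sup>2 * z + y\<^sup>2 * x + z\<^sup>2 * y"
    using pos by (simp add: T_def q_def field_simps power2_eq_square)
  have "2 * (T * q) \<le> x ^ 3 + y ^ 3 + z ^ 3 + 3 * q"
    using planar_cyclic_bound[of x y z] planar unfolding T by (simp add: q_def)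
  then have second: "T - 1 \<le> (q + x ^ 3 + y ^ 3 + z ^ 3) / (2 * q)"
    using q by (simp add: field_simps)

  have "3 * q \<le> T * q"
    using cyclic_amgm[of x y z] pos unfolding T by (simp add: q_def mult_ac)
  then have "3 \<le> T" using q by simp
  then have "2 / 3 * T \<le> T - 1" "2 \<le> 2 / 3 * T" by simp_all
  then show ?thesis
    using first second unfolding T_def x_def[symmetric] y_def[symmetric] z_def[symmetric]
    by (simp only: q_def mult.assoc simp_thms)
qed

end
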